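(* Let $(X_t)_{t\ge0},(Y_t)_{t\ge0},(Z_t)_{t\ge0}$ be sequences of non-negative real numbers and $(a_t)_{t\ge0}$ a sequence of positive real numbers such that 1. $\sum_t a_t<\infty$ and $\sum_t Z_t<\infty$; 2. $Y_t\le(1+a_{t-1})Y_{t-1}-X_{t-1}+Z_{t-1}$ for all $t\ge1$. Then $\sup_t Y_t<\infty$ and $\sum_t X_t<\infty$. *)

theory Defs
  imports Complex_Main
begin

end

theory Submission
  imports Defs
begin

text \<open>A discrete Gronwall argument: since \<open>X \<ge> 0\<close>, the quantity \<open>Y n + (\<Sum>k<n. X k)\<close> satisfies the
  same recursive inequality as \<open>Y\<close>, but without the term \<open>- X n\<close>; as \<open>1 + a n \<le> exp (a n)\<close>, it is
  at most \<open>exp (\<Sum>k<n. a k) * (Y 0 + (\<Sum>k<n. Z k))\<close>, which is bounded. This bounds \<open>Y\<close> and the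
  partial sums of \<open>X\<close> at once.\<close>

lemma almost_supermartingale_bound:
  fixes X Y Z a :: "nat \<Rightarrow> real"
  assumes X: "\<And>t. X t \<ge> 0" and Y: "\<And>t. Y t \<ge> 0" and Z: "\<And>t. Z t \<ge> 0" and a: "\<And>t. a t \<ge> 0"
    and step: "\<And>t. Y (Suc t) \<le> (1 + a t) * Y t - X t + Z t"
  shows "Y n + (\<Sum>k<n. X k) \<le> exp (\<Sum>k<n. a k) * (Y 0 + (\<Sum>k<n. Z k))"
proof (induction n)
  case 0
  show ?case by simp
next
  case (Suc n)
  let ?S = "\<Sum>k<n. X k" and ?A = "\<Sum>k<n. a k" and ?B = "Y 0 + (\<Sum>k<n. Z k)"
  have S: "?S \<ge> 0" and A: "?A + a n \<ge> 0" using X a by (simp_all add: sum_nonneg)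
  have "Y (Suc n) + (?S + X n) \<le> (1 + a n) * Y n + ?S + Z n"
    using step[of n] by simp
  \<comment> \<open>The gap is \<open>a n * ?S\<close>, nonnegative since \<open>a\<close> and
    \<open>X\<close> are; \<open>Y n + ?S\<close> is the quantity bounded by the induction
    hypothesis.\<close>
  also have "\<dots> \<le> (1 + a n) * (Y n + ?S) + Z n"
    using a[of n] S by (simp add: algebra_simps)
  also have "\<dots> \<le> exp (a n) * (exp ?A * ?B) + Z n"
    using Suc.IH a[of n] Y[of n] S by (intro add_right_mono mult_mono) auto
  \<comment> \<open>As \<open>?A + a n\<close> is nonnegative, its exponential is at least 1, so
    \<open>Z n\<close> can take the same factor as \<open>?B\<close>.\<close>
  also have "\<dots> \<le> exp (?A + a n) * ?B + exp (?A + a n) * Z n"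
    using mult_right_mono[of 1 "exp (?A + a n)" "Z n"] one_le_exp_iff[of "?A + a n"] A Z[of n]
    by (simp add: exp_add mult_ac)
  finally show ?case by (simp add: algebra_simps)
qed

theorem proposition2p4:
  fixes X Y Z a :: "nat \<Rightarrow> real"
  assumes "\<And>t. X t \<ge> 0" and "\<And>t. Y t \<ge> 0" and "\<And>t. Z t \<ge> 0"
    and "\<And>t. a t > 0"
    and "summable a" and "summable Z"
    and "\<And>t. t \<ge> 1 \<Longrightarrow> Y t \<le> (1 + a (t - 1)) * Y (t - 1) - X (t - 1) + Z (t - 1)"
  shows "bdd_above (range Y) \<and> summable X"
proof -
  define C where "C = exp (suminf a) * (Y 0 + suminf Z)"
  have a: "\<And>t. a t \<ge> 0" using assms(4) less_imp_le by blast
  have bound: "Y n + (\<Sum>k<n. X k) \<le> C" for n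
  proof -
    have "Y n + (\<Sum>k<n. X k) \<le> exp (\<Sum>k<n. a k) * (Y 0 + (\<Sum>k<n. Z k))"
      using assms(7)[of "Suc t" for t]
      by (intro almost_supermartingale_bound assms(1-3) a) simp
    also have "\<dots> \<le> C"
      unfolding C_def using a assms(2,3,5,6)
      by (intro mult_mono add_mono) (simp_all add: sum_le_suminf sum_nonneg)
    finally show ?thesis .
  qed
  have "Y n \<le> C" for n
    using bound[of n] sum_nonneg[of "{..<n}" X] assms(1) by simp
  then have "bdd_above (range Y)" by (auto intro: bdd_aboveI[where M = C])
  \<comment> \<open>The bound is used at \<open>Suc n\<close> because the sum here includes the
    index \<open>n\<close>; the nonnegative \<open>Y (Suc n)\<close> is dropped.\<close>
  moreover have "(\<Sum>k\<le>n. X k) \<le> C" for n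
    using bound[of "Suc n"] assms(2)[of "Suc n"] by (simp add: lessThan_Suc_atMost)
  then have "summable X" using assms(1) by (intro bounded_imp_summable)
  ultimately show ?thesis by blast
qed

end
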